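(* Let $T_0\in\{0,+\infty\}$ and let $\{\gamma_t: t\in(-\infty,T_0)\}$ be an ancient simple closed solution to the curve shortening flow in $\mathbb{H}^2$. Then $T_0=0$.
   Context: $\mathbb{H}^2$ is the hyperbolic plane of curvature $-1$ (upper half-plane $\{y>0\}$ with metric $\frac{dx^2+dy^2}{y^2}$). A smooth family of curves $\gamma_t$ is a solution of the curve shortening flow if $(\partial_t\gamma_t)^\perp=\kappa(t,\cdot)N(t,\cdot)$, where $\kappa(t,\cdot)$ and $N(t,\cdot)$ are the geodesic curvature and unit normal of $\gamma_t$ and $\perp$ denotes the normal component. The solution is ancient if its time interval is $(-\infty,T_0)$. It is simple closed ("simply closed") if each $\gamma_t$ is a simple closed curve. Convention: if the final time of an ancient solution is finite, time is shifted so that it equals $0$; thus $T_0$ is either $0$ or $+\infty$. *)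

theory Defs
  imports "HOL-Analysis.Analysis"
begin

text \<open>\<open>C^\<infinity>\<close> maps on an open set: all iterated directional derivatives exist and are
  differentiable in the Frechet sense.\<close>

fun C_k_on :: "nat \<Rightarrow> ('a::real_normed_vector \<Rightarrow> 'b::real_normed_vector) \<Rightarrow> 'a set \<Rightarrow> bool"
where
  "C_k_on 0 f U \<longleftrightarrow> continuous_on U f"
| "C_k_on (Suc k) f U \<longleftrightarrow> (\<forall>x\<in>U. f differentiable (at x)) \<and>
     (\<forall>v. C_k_on k (\<lambda>x. frechet_derivative f (at x) v) U)"

definition smooth_on :: "('a::real_normed_vector \<Rightarrow> 'b::real_normed_vector) \<Rightarrow> 'a set \<Rightarrow> bool"
where
  "smooth_on f U \<longleftrightarrow> (\<forall>k. C_k_on k f U)"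

definition half_plane :: "complex set"
where
  "half_plane = {z. Im z > 0}"

text \<open>The Riemannian metric \<open>(dx\<^sup>2 + dy\<^sup>2) / y\<^sup>2\<close> at \<open>z = x + i y\<close>.\<close>

definition hyp_metric :: "complex \<Rightarrow> complex \<Rightarrow> complex \<Rightarrow> real"
where
  "hyp_metric z v w = (v \<bullet> w) / (Im z)\<^sup>2"

definition hyp_norm :: "complex \<Rightarrow> complex \<Rightarrow> real"
where
  "hyp_norm z v = sqrt (hyp_metric z v v)"

abbreviation velocity :: "(real \<Rightarrow> complex) \<Rightarrow> real \<Rightarrow> complex"
where
  "velocity c u \<equiv> vector_derivative c (at u)"

text \<open>Covariant derivative of a vector field \<open>X\<close> along the curve \<open>c\<close>. The Christoffel symbols of
  the half-plane are \<open>\<Gamma>\<^sup>x\<^sub>x\<^sub>y = \<Gamma>\<^sup>x\<^sub>y\<^sub>x = -1/y\<close>, \<open>\<Gamma>\<^sup>y\<^sub>x\<^sub>x = 1/y\<close>, \<open>\<Gamma>\<^sup>y\<^sub>y\<^sub>y = -1/y\<close> and zero otherwise,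
  which in complex notation reads \<open>\<Gamma>(v, w) = (i/y) v w\<close>. This is symmetric in \<open>v\<close>, \<open>w\<close>, and
  \<open>hyp_metric_compatible\<close> below shows that it is metric, so it is the Levi-Civita connection.\<close>

definition cov_deriv :: "(real \<Rightarrow> complex) \<Rightarrow> (real \<Rightarrow> complex) \<Rightarrow> real \<Rightarrow> complex"
where
  "cov_deriv c X u =
     vector_derivative X (at u) + (\<i> / complex_of_real (Im (c u))) * velocity c u * X u"

definition unit_tangent :: "(real \<Rightarrow> complex) \<Rightarrow> real \<Rightarrow> complex"
where
  "unit_tangent c u = velocity c u /\<^sub>R hyp_norm (c u) (velocity c u)"

text \<open>The metric is conformal, so multiplication by \<open>i\<close> is rotation by a right angle. The other
  choice of unit normal changes the sign of both \<open>\<kappa>\<close> and \<open>N\<close>, leaving \<open>\<kappa> N\<close> unchanged.\<close>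

definition unit_normal :: "(real \<Rightarrow> complex) \<Rightarrow> real \<Rightarrow> complex"
where
  "unit_normal c u = \<i> * unit_tangent c u"

text \<open>\<open>\<kappa> = g(\<nabla>\<^sub>T T, N)\<close>, where \<open>\<nabla>\<^sub>T\<close> is the covariant derivative along \<open>c\<close> divided by the
  speed of \<open>c\<close>.\<close>

definition geodesic_curvature :: "(real \<Rightarrow> complex) \<Rightarrow> real \<Rightarrow> real"
where
  "geodesic_curvature c u =
     hyp_metric (c u)
       (cov_deriv c (unit_tangent c) u /\<^sub>R hyp_norm (c u) (velocity c u))
       (unit_normal c u)"

definition normal_component :: "(real \<Rightarrow> complex) \<Rightarrow> real \<Rightarrow> complex \<Rightarrow> complex"
where
  "normal_component c u v =
     v - hyp_metric (c u) v (unit_tangent c u) *\<^sub>R unit_tangent c u"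

text \<open>Closed curves are maps on the circle \<open>\<real>/\<int>\<close>, i.e. 1-periodic functions on the line;
  \<^const>\<open>simple_path\<close> looks only at one period \<open>[0, 1]\<close> and allows its end points to coincide.
  Curves are regular (immersed), so that \<open>T\<close> and \<open>N\<close> are defined.\<close>

definition simple_closed_curve :: "(real \<Rightarrow> complex) \<Rightarrow> bool"
where
  "simple_closed_curve c \<longleftrightarrow>
     range c \<subseteq> half_plane \<and> (\<forall>u. c (u + 1) = c u) \<and> simple_path c \<and>
     smooth_on c UNIV \<and> (\<forall>u. velocity c u \<noteq> 0)"

definition ancient_times :: "ereal \<Rightarrow> real set"
where
  "ancient_times T0 = {t. ereal t < T0}"

definition ancient_simple_closed_CSF :: "ereal \<Rightarrow> (real \<Rightarrow> real \<Rightarrow> complex) \<Rightarrow> bool"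
where
  "ancient_simple_closed_CSF T0 \<gamma> \<longleftrightarrow>
     smooth_on (\<lambda>(t, u). \<gamma> t u) (ancient_times T0 \<times> UNIV) \<and>
     (\<forall>t\<in>ancient_times T0. simple_closed_curve (\<gamma> t)) \<and>
     (\<forall>t\<in>ancient_times T0. \<forall>u.
        normal_component (\<gamma> t) u (vector_derivative (\<lambda>s. \<gamma> s u) (at t)) =
        geodesic_curvature (\<gamma> t) u *\<^sub>R unit_normal (\<gamma> t) u)"

lemma hyp_metric_compatible:
  assumes "Im (c u) \<noteq> 0"
    and c: "c differentiable (at u)" and X: "X differentiable (at u)" and Y: "Y differentiable (at u)"
  shows "((\<lambda>s. hyp_metric (c s) (X s) (Y s)) has_real_derivative
           hyp_metric (c u) (cov_deriv c X u) (Y u) + hyp_metric (c u) (X u) (cov_deriv c Y u)) (at u)"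
proof -
  have D: "((\<lambda>s. Re (f s)) has_real_derivative Re (vector_derivative f (at u))) (at u)"
    "((\<lambda>s. Im (f s)) has_real_derivative Im (vector_derivative f (at u))) (at u)"
    if "f differentiable (at u)" for f :: "real \<Rightarrow> complex"
    using that vector_derivative_works[of f "at u"] has_vector_derivative_complex_iff by blast+
  let ?d = "\<lambda>f. vector_derivative f (at u) :: complex"
  have deriv: "((\<lambda>s. (Re (X s) * Re (Y s) + Im (X s) * Im (Y s)) / (Im (c s))\<^sup>2) has_real_derivative
      ((Re (?d X) * Re (Y u) + Re (?d Y) * Re (X u) + (Im (?d X) * Im (Y u) + Im (?d Y) * Im (X u))) *
        (Im (c u))\<^sup>2 - (Re (X u) * Re (Y u) + Im (X u) * Im (Y u)) * (2 * Im (?d c) * Im (c u))) /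
      ((Im (c u))\<^sup>2 * (Im (c u))\<^sup>2)) (at u)"
    using assms(1) DERIV_power[OF D(2)[OF c], of 2]
    by (intro DERIV_divide DERIV_add DERIV_mult D X Y) (simp_all add: mult_ac)
  have "\<i> / complex_of_real (Im (c u)) = Complex 0 (1 / Im (c u))"
    by (simp add: complex_eq_iff Re_divide Im_divide power2_eq_square)
  then show ?thesis
    unfolding hyp_metric_def cov_deriv_def inner_complex_def
    using assms(1) by (intro DERIV_cong[OF deriv]) (simp add: field_simps power2_eq_square)
qed

end

theory Submission
  imports Defs
begin

text \<open>
  A closed curve moving by curve shortening in the hyperbolic plane dies in finite time, so that
  the time interval of a solution cannot be all of \<open>\<real>\<close>. The reason is a comparison argument with
  the function \<open>\<phi>(x + i y) = (1 + x\<^sup>2 + y\<^sup>2) / y\<close>, which is twice the hyperbolic cosine of the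
  distance to \<open>i\<close> and therefore at least \<open>2\<close>. In the hyperboloid model \<open>\<phi>\<close> is the restriction of
  a linear function, which is why its hyperbolic Hessian is \<open>\<phi>\<close> times the metric. Along a solution
  this gives \<open>\<partial>\<^sub>t \<phi> = \<phi>\<^sub>s\<^sub>s - \<phi>\<close> up to a multiple of \<open>\<phi>\<^sub>s\<close>, where \<open>s\<close> is arc length; hence
  \<open>\<partial>\<^sub>t \<phi> \<le> - \<phi> \<le> - 2\<close> wherever \<open>\<phi>\<close> is maximal along the curve
  (\<open>csf_cosh_dist_decrease\<close>). By the maximum principle (\<open>periodic_maximum_principle\<close>) the maximum of
  \<open>\<phi>\<close> over the curve decreases at least at unit speed, and so it would become negative.
\<close>

section \<open>Maximum principle for periodic functions\<close>

lemma second_derivative_nonpos_at_max: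
  fixes f :: "real \<Rightarrow> real"
  assumes f: "\<And>s. (f has_real_derivative f' s) (at s)"
    and f': "(f' has_real_derivative D) (at u)"
    and max: "\<And>s. f s \<le> f u"
  shows "f' u = 0" "D \<le> 0"
proof -
  show crit: "f' u = 0"
    by (rule DERIV_local_max[OF f, of 1]) (use max in auto)
  show "D \<le> 0"
  proof (rule ccontr)
    assume "\<not> D \<le> 0"
    then obtain d where d: "d > 0" "\<And>h. 0 < h \<Longrightarrow> h < d \<Longrightarrow> f' u < f' (u + h)"
      using DERIV_pos_inc_right[OF f'] by force
    obtain z where z: "u < z" "z < u + d / 2" "f (u + d / 2) - f u = (u + d / 2 - u) * f' z"
      using MVT2[of u "u + d / 2" f f'] f d(1) by auto
    then have "f' z > 0"
      using d(2)[of "z - u"] crit d(1) by simp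
    then have "(u + d / 2 - u) * f' z > 0"
      using d(1) by simp
    then have "f (u + d / 2) > f u"
      using z(3) by linarith
    then show False
      using max[of "u + d / 2"] by simp
  qed
qed

text \<open>
  Periodicity makes the supremum of \<open>F t u + a t\<close> over the strip a maximum. It cannot be attained
  at a positive time, because there the hypothesis makes this function strictly decreasing in \<open>t\<close>.
\<close>

lemma periodic_maximum_principle:
  fixes F :: "real \<Rightarrow> real \<Rightarrow> real"
  assumes "0 \<le> T"
    and cont: "continuous_on ({0..T} \<times> UNIV) (\<lambda>(t, u). F t u)"
    and per: "\<And>t u. t \<in> {0..T} \<Longrightarrow> F t (u + 1) = F t u"
    and decr: "\<And>t u. t \<in> {0<..T} \<Longrightarrow> (\<And>s. F t s \<le> F t u) \<Longrightarrow>
      \<exists>D < - a. ((\<lambda>r. F r u) has_real_derivative D) (at t)"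
  shows "\<exists>u\<^sub>0. \<forall>u. F T u \<le> F 0 u\<^sub>0 - a * T"
proof -
  let ?G = "\<lambda>(t, u). F t u + a * t"
  have "continuous_on ({0..T} \<times> {0..1}) ?G"
    using continuous_on_subset[OF cont, of "{0..T} \<times> {0..1}"]
    by (auto simp: case_prod_beta intro!: continuous_intros)
  then have "\<exists>p\<in>{0..T} \<times> {0..1}. \<forall>q\<in>{0..T} \<times> {0..1}. ?G q \<le> ?G p"
    using \<open>0 \<le> T\<close> by (intro continuous_attains_sup compact_Times) auto
  then obtain t\<^sub>0 u\<^sub>0 where t0: "t\<^sub>0 \<in> {0..T}"
    and max01: "\<And>t u. t \<in> {0..T} \<Longrightarrow> u \<in> {0..1} \<Longrightarrow> F t u + a * t \<le> F t\<^sub>0 u\<^sub>0 + a * t\<^sub>0"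
    by (fastforce simp del: atLeastAtMost_iff)
  have max: "F t u + a * t \<le> F t\<^sub>0 u\<^sub>0 + a * t\<^sub>0" if t: "t \<in> {0..T}" for t u
  proof -
    interpret periodic_fun_simple' "F t"
      by unfold_locales (rule per[OF t])
    have "F t u = F t (frac u)"
      using plus_of_int[of "frac u" "\<lfloor>u\<rfloor>"] by (simp add: frac_def)
    then show ?thesis
      using max01[OF t, of "frac u"] by (simp add: frac_lt_1 less_imp_le)
  qed
  have "t\<^sub>0 = 0"
  proof (rule ccontr)
    assume "t\<^sub>0 \<noteq> 0"
    then have pos: "t\<^sub>0 \<in> {0<..T}"
      using t0 by auto
    have "F t\<^sub>0 s \<le> F t\<^sub>0 u\<^sub>0" for s
      using max[OF t0, of s] by simp
    from decr[OF pos this] obtain D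
      where D: "D < - a" "((\<lambda>r. F r u\<^sub>0) has_real_derivative D) (at t\<^sub>0)"
      by blast
    have "((\<lambda>r. F r u\<^sub>0 + a * r) has_real_derivative D + a) (at t\<^sub>0)"
      by (auto intro!: derivative_eq_intros D(2))
    then obtain d where d: "d > 0"
      "\<And>h. 0 < h \<Longrightarrow> h < d \<Longrightarrow> F t\<^sub>0 u\<^sub>0 + a * t\<^sub>0 < F (t\<^sub>0 - h) u\<^sub>0 + a * (t\<^sub>0 - h)"
      using DERIV_neg_dec_left[of "\<lambda>r. F r u\<^sub>0 + a * r" "D + a" t\<^sub>0] D(1) by auto
    define h where "h = min (d / 2) t\<^sub>0"
    have "0 < h" "h < d" "t\<^sub>0 - h \<in> {0..T}"
      using d(1) pos by (auto simp: h_def)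
    then show False
      using d(2)[of h] max[of "t\<^sub>0 - h" u\<^sub>0] by simp
  qed
  then show ?thesis
    using max[of T] \<open>0 \<le> T\<close> by (intro exI[of _ u\<^sub>0]) (auto simp: algebra_simps)
qed

section \<open>Normal speed of a solution\<close>

text \<open>
  Normalising the velocity only adds to its covariant derivative a multiple of the velocity, which
  is orthogonal to the normal. So no derivative of the speed survives in the curvature.
\<close>

lemma geodesic_curvature_eq:
  assumes y: "Im (c u) > 0"
    and c: "c differentiable (at u)"
    and v: "(velocity c has_vector_derivative w) (at u)"
    and nz: "velocity c u \<noteq> 0"
  shows "geodesic_curvature c u =
    Im (c u) / norm (velocity c u) ^ 3 *
      (w \<bullet> (\<i> * velocity c u) + (norm (velocity c u))\<^sup>2 * Re (velocity c u) / Im (c u))"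
proof -
  let ?v = "velocity c u"
  define \<rho> where "\<rho> s = inverse (hyp_norm (c s) (velocity c s))" for s
  have \<rho>: "\<rho> u = Im (c u) / norm ?v"
    using y by (simp add: \<rho>_def hyp_norm_def hyp_metric_def real_sqrt_divide norm_eq_sqrt_inner)
  have "(\<lambda>s. Im (c s)) differentiable (at u)" "velocity c differentiable (at u)"
    using c v by (auto intro: differentiableI_vector
      differentiable_compose[where f = Im, OF bounded_linear_imp_differentiable[OF bounded_linear_Im]])
  then have "(\<lambda>s. hyp_metric (c s) (velocity c s) (velocity c s)) differentiable (at u)"
    unfolding hyp_metric_def using y by (auto intro!: derivative_intros)
  then obtain m where m: "((\<lambda>s. hyp_metric (c s) (velocity c s) (velocity c s)) has_real_derivative m) (at u)"
    using real_differentiableE by blast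
  have pos: "hyp_metric (c u) ?v ?v > 0"
    using y nz by (simp add: hyp_metric_def)
  obtain \<rho>' where \<rho>': "(\<rho> has_real_derivative \<rho>') (at u)"
    using DERIV_inverse_fun[OF DERIV_chain2[OF DERIV_real_sqrt[OF pos] m]] pos
    unfolding \<rho>_def[abs_def] hyp_norm_def by auto
  have T: "unit_tangent c = (\<lambda>s. \<rho> s *\<^sub>R velocity c s)"
    by (auto simp: unit_tangent_def \<rho>_def)
  have "(unit_tangent c has_vector_derivative \<rho> u *\<^sub>R w + \<rho>' *\<^sub>R ?v) (at u)"
    unfolding T by (rule has_vector_derivative_scaleR[OF \<rho>' v])
  then have D: "vector_derivative (unit_tangent c) (at u) = \<rho> u *\<^sub>R w + \<rho>' *\<^sub>R ?v"
    by (rule vector_derivative_at)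
  have i: "\<i> / complex_of_real (Im (c u)) = Complex 0 (1 / Im (c u))"
    by (simp add: complex_eq_iff Re_divide Im_divide power2_eq_square)
  have n2: "(norm ?v)\<^sup>2 = (Re ?v)\<^sup>2 + (Im ?v)\<^sup>2"
    by (simp add: cmod_power2)
  have "geodesic_curvature c u = \<rho> u ^ 3 / (Im (c u))\<^sup>2 *
      (w \<bullet> (\<i> * ?v) + ((Re ?v)\<^sup>2 + (Im ?v)\<^sup>2) * Re ?v / Im (c u))"
    using y unfolding geodesic_curvature_def cov_deriv_def unit_normal_def D
    unfolding T hyp_metric_def i \<rho>_def[symmetric] inner_complex_def
    by (simp add: field_simps power2_eq_square power3_eq_cube)
  also have "\<rho> u ^ 3 / (Im (c u))\<^sup>2 = Im (c u) / norm ?v ^ 3"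
    using y by (simp add: \<rho> power_divide power2_eq_square power3_eq_cube)
  finally show ?thesis
    by (simp only: n2)
qed

text \<open>
  Pairing the flow equation with \<open>i v\<close>, where \<open>v\<close> is the velocity of the curve, removes the
  tangential part of the motion, which the flow leaves undetermined.
\<close>

lemma csf_normal_speed:
  assumes y: "Im (c u) > 0"
    and c: "c differentiable (at u)"
    and v: "(velocity c has_vector_derivative w) (at u)"
    and nz: "velocity c u \<noteq> 0"
    and flow: "normal_component c u X = geodesic_curvature c u *\<^sub>R unit_normal c u"
  shows "(norm (velocity c u))\<^sup>2 * (X \<bullet> (\<i> * velocity c u)) =
    (Im (c u))\<^sup>2 * (w \<bullet> (\<i> * velocity c u)) +
      Im (c u) * (norm (velocity c u))\<^sup>2 * Re (velocity c u)"
proof -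
  let ?v = "velocity c u" and ?n = "norm (velocity c u)" and ?y = "Im (c u)"
  have T: "unit_tangent c u = (?y / ?n) *\<^sub>R ?v"
    using y by (simp add: unit_tangent_def hyp_norm_def hyp_metric_def real_sqrt_divide
        norm_eq_sqrt_inner)
  have orth: "?v \<bullet> (\<i> * ?v) = 0"
    by (simp add: inner_complex_def)
  have rot: "(\<i> * ?v) \<bullet> (\<i> * ?v) = ?n\<^sup>2"
    by (simp add: power2_norm_eq_inner[symmetric] norm_mult)
  have "X \<bullet> (\<i> * ?v) = normal_component c u X \<bullet> (\<i> * ?v)"
    by (simp add: normal_component_def T inner_diff_left orth)
  also have "\<dots> = geodesic_curvature c u * (?y / ?n * ?n\<^sup>2)"
    using rot by (simp add: flow unit_normal_def T)
  finally have "?n\<^sup>2 * (X \<bullet> (\<i> * ?v)) = ?n ^ 3 * ?y * geodesic_curvature c u"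
    using nz by (simp add: power2_eq_square power3_eq_cube)
  also have "\<dots> = ?y\<^sup>2 * (w \<bullet> (\<i> * ?v)) + ?y * ?n\<^sup>2 * Re ?v"
    using y nz by (simp add: geodesic_curvature_eq[OF y c v nz] field_simps power2_eq_square)
  finally show ?thesis .
qed

section \<open>Decrease of the distance to a fixed point\<close>

text \<open>Twice the hyperbolic cosine of the hyperbolic distance from \<open>z\<close> to \<open>i\<close>.\<close>

definition cosh_dist :: "complex \<Rightarrow> real"
where
  "cosh_dist z = (1 + (Re z)\<^sup>2 + (Im z)\<^sup>2) / Im z"

lemma cosh_dist_ge_2:
  assumes "Im z > 0"
  shows "cosh_dist z \<ge> 2"
proof -
  have "0 \<le> (Re z)\<^sup>2 + (Im z - 1)\<^sup>2"
    by simp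
  then show ?thesis
    using assms by (simp add: cosh_dist_def field_simps power2_eq_square)
qed

definition cosh_dist_deriv :: "complex \<Rightarrow> complex \<Rightarrow> real"
where
  "cosh_dist_deriv z v =
     2 * Re z * Re v / Im z + (1 - (1 + (Re z)\<^sup>2) / (Im z)\<^sup>2) * Im v"

lemma has_real_derivative_Re_Im:
  assumes "(c has_vector_derivative v) (at s)"
  shows "((\<lambda>r. Re (c r)) has_real_derivative Re v) (at s)"
    and "((\<lambda>r. Im (c r)) has_real_derivative Im v) (at s)"
  using assms has_vector_derivative_complex_iff by blast+

lemma cosh_dist_has_derivative:
  assumes "(c has_vector_derivative v) (at s)" "Im (c s) > 0"
  shows "((\<lambda>r. cosh_dist (c r)) has_real_derivative cosh_dist_deriv (c s) v) (at s)"
  unfolding cosh_dist_def cosh_dist_deriv_def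
  by (rule has_real_derivative_Re_Im[OF assms(1)] derivative_eq_intros refl)+
    (use assms(2) in \<open>auto simp: field_simps power2_eq_square\<close>)

text \<open>The last summand is the Euclidean Hessian of \<^const>\<open>cosh_dist\<close> in direction \<open>v\<close>.\<close>

lemma cosh_dist_deriv_has_derivative:
  assumes "(c has_vector_derivative v s) (at s)" "(v has_vector_derivative w) (at s)" "Im (c s) > 0"
  shows "((\<lambda>r. cosh_dist_deriv (c r) (v r)) has_real_derivative
    cosh_dist_deriv (c s) w +
      2 * ((Im (c s) * Re (v s) - Re (c s) * Im (v s))\<^sup>2 + (Im (v s))\<^sup>2) / Im (c s) ^ 3) (at s)"
proof -
  have nz: "Im (c s) \<noteq> 0" "(Im (c s))\<^sup>2 \<noteq> 0"
    using assms(3) by auto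
  show ?thesis
    unfolding cosh_dist_deriv_def
    by (rule has_real_derivative_Re_Im[OF assms(1)] has_real_derivative_Re_Im[OF assms(2)]
        derivative_eq_intros nz refl)+
      (use nz in \<open>simp add: field_simps power2_eq_square power3_eq_cube\<close>)
qed

text \<open>
  This is the equation \<open>Hess \<phi> = \<phi> g\<close> on a nonzero tangent vector \<open>v\<close> orthogonal to the
  gradient of \<open>\<phi>\<close>: the left-hand side is \<open>y\<^sup>2\<close> times the Euclidean Hessian, and the last term on the right is the
  contribution of the Christoffel symbols, since the gradient is then a multiple of \<open>i v\<close>.
\<close>

lemma cosh_dist_hessian:
  assumes y: "Im z > 0" and crit: "cosh_dist_deriv z v = 0"
  shows "2 * ((Im z * Re v - Re z * Im v)\<^sup>2 + (Im v)\<^sup>2) / Im z =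
    cosh_dist z * (norm v)\<^sup>2 + Im z * Re v * cosh_dist_deriv z (\<i> * v)"
proof -
  define x p q where "x = Re z" "p = Re v" "q = Im v"
  define y where "y = Im z"
  have y0: "y > 0"
    using y by (simp add: y_def)
  have g: "2 * x * p * y + (y\<^sup>2 - 1 - x\<^sup>2) * q = 0"
    using crit y0 unfolding cosh_dist_deriv_def x_p_q_def[symmetric] y_def[symmetric]
    by (simp add: field_simps power2_eq_square)
  define K where "K = (y\<^sup>2 - 1 - x\<^sup>2) * p - 2 * x * y * q"
  have "2 * ((y * p - x * q)\<^sup>2 + q\<^sup>2) = (1 + x\<^sup>2 + y\<^sup>2) * (p\<^sup>2 + q\<^sup>2) + p * K"
    using g unfolding K_def by algebra
  moreover have "y * p * cosh_dist_deriv z (\<i> * v) = p * K / y"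
    using y0 unfolding cosh_dist_deriv_def K_def
    by (simp add: x_p_q_def[symmetric] y_def[symmetric] field_simps power2_eq_square)
  ultimately show ?thesis
    unfolding cosh_dist_def cmod_power2
    by (simp only: x_p_q_def[symmetric] y_def[symmetric] times_divide_eq_left
        add_divide_distrib[of _ "p * K"])
qed

text \<open>In the plane, a linear form that vanishes at \<open>v \<noteq> 0\<close> is a multiple of pairing with \<open>i v\<close>.\<close>

lemma cosh_dist_deriv_orthogonal:
  assumes "cosh_dist_deriv z v = 0"
  shows "(norm v)\<^sup>2 * cosh_dist_deriv z w = cosh_dist_deriv z (\<i> * v) * (w \<bullet> (\<i> * v))"
proof -
  define g h where "g = 2 * Re z / Im z" "h = 1 - (1 + (Re z)\<^sup>2) / (Im z)\<^sup>2"
  have d: "cosh_dist_deriv z w = g * Re w + h * Im w" for w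
    by (simp add: cosh_dist_deriv_def g_h_def)
  have "g * Re v + h * Im v = 0"
    using assms by (simp add: d)
  then show ?thesis
    unfolding d cmod_power2 inner_complex_def by simp algebra
qed

text \<open>
  At a maximum of \<open>\<phi>\<close> along the curve, \<open>\<phi>\<^sub>u\<^sub>u \<le> 0\<close> splits into the normal part of the covariant
  acceleration, which the flow turns into \<open>\<partial>\<^sub>t \<phi>\<close>, and the hyperbolic Hessian of \<open>\<phi>\<close>, which is
  \<open>\<phi> \<bar>v\<bar>\<^sup>2 / y\<^sup>2\<close>.
\<close>

lemma csf_cosh_dist_decrease:
  assumes y: "\<And>s. Im (c s) > 0"
    and c: "\<And>s. c differentiable (at s)"
    and v: "velocity c differentiable (at u)"
    and nz: "velocity c u \<noteq> 0"
    and flow: "normal_component c u X = geodesic_curvature c u *\<^sub>R unit_normal c u"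
    and max: "\<And>s. cosh_dist (c s) \<le> cosh_dist (c u)"
  shows "cosh_dist_deriv (c u) X \<le> - cosh_dist (c u)"
proof -
  let ?v = "velocity c u" and ?y = "Im (c u)"
  define w where "w = vector_derivative (velocity c) (at u)"
  define A where "A = cosh_dist_deriv (c u) (\<i> * ?v)"
  define E where "E = 2 * ((?y * Re ?v - Re (c u) * Im ?v)\<^sup>2 + (Im ?v)\<^sup>2)"
  have c': "(c has_vector_derivative velocity c s) (at s)" for s
    using c vector_derivative_works by blast
  have w: "(velocity c has_vector_derivative w) (at u)"
    using v vector_derivative_works w_def by blast
  note extremal = second_derivative_nonpos_at_max[OF cosh_dist_has_derivative[OF c' y]
      cosh_dist_deriv_has_derivative[OF c' w y] max]
  note crit = extremal(1)
  have n: "(norm ?v)\<^sup>2 > 0"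
    using nz by simp
  have "E / ?y ^ 3 = (E / ?y) / ?y\<^sup>2"
    by (simp add: power2_eq_square power3_eq_cube)
  then have "cosh_dist_deriv (c u) w + (E / ?y) / ?y\<^sup>2 \<le> 0"
    using extremal(2) by (simp only: E_def)
  then have second: "?y\<^sup>2 * cosh_dist_deriv (c u) w + E / ?y \<le> 0"
    using y[of u] by (simp add: field_simps)
  have "(norm ?v)\<^sup>2 * ((norm ?v)\<^sup>2 * cosh_dist_deriv (c u) X)
      = A * ((norm ?v)\<^sup>2 * (X \<bullet> (\<i> * ?v)))"
    using cosh_dist_deriv_orthogonal[OF crit, of X] by (simp add: A_def)
  also have "\<dots> = ?y\<^sup>2 * (A * (w \<bullet> (\<i> * ?v))) + (norm ?v)\<^sup>2 * (?y * Re ?v * A)"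
    unfolding csf_normal_speed[OF y c w nz flow] by (simp add: algebra_simps)
  also have "\<dots> = (norm ?v)\<^sup>2 * (?y\<^sup>2 * cosh_dist_deriv (c u) w + ?y * Re ?v * A)"
    using cosh_dist_deriv_orthogonal[OF crit, of w] by (simp add: A_def algebra_simps)
  finally have "(norm ?v)\<^sup>2 * cosh_dist_deriv (c u) X
      = ?y\<^sup>2 * cosh_dist_deriv (c u) w + ?y * Re ?v * A"
    using n by (metis mult_cancel_left less_irrefl)
  also have "\<dots> \<le> (norm ?v)\<^sup>2 * (- cosh_dist (c u))"
    using second cosh_dist_hessian[OF y crit] by (simp add: E_def A_def algebra_simps)
  finally show ?thesis
    using n by (simp only: mult_le_cancel_left_pos)
qed

section \<open>Ancient solutions are not eternal\<close>

lemma smooth_on_differentiable: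
  assumes "smooth_on f U" "x \<in> U"
  shows "f differentiable (at x)"
  using assms C_k_on.simps(2)[of 0 f U] by (auto simp: smooth_on_def simp del: C_k_on.simps)

lemma smooth_on_velocity_differentiable:
  fixes c :: "real \<Rightarrow> complex"
  assumes "smooth_on c UNIV"
  shows "velocity c differentiable (at u)"
proof -
  have c: "c differentiable (at s)" for s
    using smooth_on_differentiable[OF assms] by simp
  have "C_k_on (Suc (Suc 0)) c UNIV"
    using assms by (simp add: smooth_on_def del: C_k_on.simps)
  then have "(\<lambda>s. frechet_derivative c (at s) 1) differentiable (at u)"
    by simp
  then show ?thesis
    by (simp add: frechet_derivative_eq_vector_derivative c)
qed

theorem corollary5p2:
  fixes T0 :: ereal and \<gamma> :: "real \<Rightarrow> real \<Rightarrow> complex"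
  assumes "T0 \<in> {0, \<infinity>}"
    and "ancient_simple_closed_CSF T0 \<gamma>"
  shows "T0 = 0"
proof (rule ccontr)
  assume "T0 \<noteq> 0"
  then have "ancient_times T0 = UNIV"
    using assms(1) by (auto simp: ancient_times_def)
  then have smooth: "smooth_on (\<lambda>(t, u). \<gamma> t u) UNIV"
    and simple: "\<And>t. simple_closed_curve (\<gamma> t)"
    and flow: "\<And>t u. normal_component (\<gamma> t) u (vector_derivative (\<lambda>s. \<gamma> s u) (at t)) =
      geodesic_curvature (\<gamma> t) u *\<^sub>R unit_normal (\<gamma> t) u"
    using assms(2) by (auto simp: ancient_simple_closed_CSF_def)
  have y: "Im (\<gamma> t u) > 0" and per: "\<gamma> t (u + 1) = \<gamma> t u"
    and regular: "velocity (\<gamma> t) u \<noteq> 0" and smooth_u: "smooth_on (\<gamma> t) UNIV" for t u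
    using simple[of t] by (auto simp: simple_closed_curve_def half_plane_def)
  have diff_t: "(\<lambda>s. \<gamma> s u) differentiable (at t)" for t u
    using differentiable_compose[of "\<lambda>(t, u). \<gamma> t u" "\<lambda>s. (s, u)" t UNIV]
      smooth_on_differentiable[OF smooth]
    by (simp add: differentiable_Pair)
  define F where "F t u = cosh_dist (\<gamma> t u)" for t u
  have "continuous_on UNIV (\<lambda>(t, u). \<gamma> t u)"
    using smooth C_k_on.simps(1) unfolding smooth_on_def by blast
  then have cont: "continuous_on UNIV (\<lambda>(t, u). F t u)"
    using y unfolding F_def cosh_dist_def case_prod_beta
    by (auto intro!: continuous_intros simp: less_imp_neq[symmetric])
  have decr: "\<exists>D < - 1. ((\<lambda>r. F r u) has_real_derivative D) (at t)"
    if max: "\<And>s. F t s \<le> F t u" for t u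
  proof -
    let ?X = "vector_derivative (\<lambda>s. \<gamma> s u) (at t)"
    have "cosh_dist_deriv (\<gamma> t u) ?X \<le> - cosh_dist (\<gamma> t u)"
      using max unfolding F_def
      by (intro csf_cosh_dist_decrease y regular flow smooth_on_velocity_differentiable
          smooth_on_differentiable[OF smooth_u] smooth_u) auto
    then have "cosh_dist_deriv (\<gamma> t u) ?X < - 1"
      using cosh_dist_ge_2[OF y, of t u] by simp
    moreover have "((\<lambda>r. F r u) has_real_derivative cosh_dist_deriv (\<gamma> t u) ?X) (at t)"
      unfolding F_def using diff_t y
      by (intro cosh_dist_has_derivative) (auto simp: vector_derivative_works[symmetric])
    ultimately show ?thesis
      by blast
  qed
  have bound: "\<exists>u\<^sub>0. \<forall>u. F T u \<le> F 0 u\<^sub>0 - T" if "0 \<le> T" for T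
    using periodic_maximum_principle[of T F 1] that decr
      continuous_on_subset[OF cont] per by (simp add: F_def)
  \<comment> \<open>The bound at time \<open>0\<close> says that \<open>\<phi>\<close> has a maximum on the initial curve, which then serves
    as the time at which the bound turns \<open>\<phi>\<close> nonpositive.\<close>
  obtain u\<^sub>0 where u0: "\<And>u. F 0 u \<le> F 0 u\<^sub>0"
    using bound[of 0] by auto
  have pos: "F t u > 0" for t u
    using cosh_dist_ge_2[OF y, of t u] by (simp add: F_def)
  obtain u\<^sub>1 where "F (F 0 u\<^sub>0) 0 \<le> F 0 u\<^sub>1 - F 0 u\<^sub>0"
    using bound[of "F 0 u\<^sub>0"] pos[of 0 u\<^sub>0] by auto
  then show False
    using u0[of u\<^sub>1] pos[of "F 0 u\<^sub>0" 0] by simp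
qed

end
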